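(* Let $S$ be a $\mathrm{Cu}$-semigroup satisfying (O5), (O6), (O7) and (O8), let $I$ be an ideal in $S$, and let $n_1,n_2\in\mathbb{N}$. Assume that $S/I$ is $n_1$-almost divisible and that $I$ is $n_2$-almost divisible. Then $S$ is $n$-almost divisible for $n=\max\{2n_1+1,2n_2+1\}$.
   Context: A $\mathrm{Cu}$-semigroup is a positively ordered (commutative) monoid $S$ (partial order compatible with addition, $0\leq x$ for all $x$) such that: (O1) increasing sequences have suprema; (O2) every element is the supremum of a sequence $(x_n)_n$ with $x_n\ll x_{n+1}$; (O3) $x'\ll x$ and $y'\ll y$ imply $x'+y'\ll x+y$; (O4) $\sup_n(x_n+y_n)=\sup_n x_n+\sup_n y_n$ for increasing sequences. Here $x\ll y$ means: for every increasing sequence $(y_n)_n$ with $y\leq\sup_n y_n$ there is $n$ with $x\leq y_n$. Additional axioms: (O5) for all $r',r,s',s,t\in S$ with $r+s\leq t$, $r'\ll r$, $s'\ll s$ there is $u\in S$ with $r'+u\leq t\leq r+u$ and $s'\ll u$. (O6) for all $x',x,y,z$ with $x'\ll x\leq y+z$ there are $e,f$ with $x'\leq e+f$, $e\leq x,y$ and $f\leq x,z$. (O7) for all $x_1',x_1,x_2',x_2,w$ with $x_1'\ll x_1\leq w$ and $x_2'\ll x_2\leq w$ there is $x$ with $x_1',x_2'\ll x$ and $x\leq w$, $x\leq x_1+x_2$. (O8) for all $x',x,y',y,z,w$ with $x+y\ll z+w$, $x'\ll x$, $y'\ll y$ and $2w=w$ there are $z_1,z_2$ with $z_1+z_2\ll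 z$, $x'\ll z_1+w$, $y'\ll z_2+w$, $z_1\ll x+w$, $z_2\ll y+w$. An ideal of $S$ is a submonoid $I\subseteq S$ closed under suprema of increasing sequences and downward hereditary ($x\leq y\in I$ implies $x\in I$). Write $x\leq_I y$ if $x\leq y+w$ for some $w\in I$, and $x\sim_I y$ if $x\leq_I y$ and $y\leq_I x$; $S/I$ is the set of $\sim_I$-classes with the induced addition and order, which is a $\mathrm{Cu}$-semigroup. An ideal is a $\mathrm{Cu}$-semigroup with the induced structure. For $n\in\mathbb{N}$ ($\mathbb{N}$ includes $0$), $S$ is $n$-almost divisible if for any $k\in\mathbb{N}$ and $x'\ll x$ in $S$ there is $y\in S$ with $ky\leq x$ and $x'\leq(k+1)(n+1)y$. *)

theory Defs
  imports "HOL-Algebra.Group"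
begin

text \<open>
  Monoids with an order, given by explicit carriers so that a semigroup, its ideals and its
  quotients are objects of the same kind. The underlying monoid is the one of
  HOL-Algebra, written additively here: in particular \<open>k \<cdot> x\<close> is its \<open>k\<close>-th power.
\<close>

record 'a ord_monoid = "'a monoid" +
  leq :: "'a \<Rightarrow> 'a \<Rightarrow> bool" (infix \<open>\<preceq>\<index>\<close> 50)

abbreviation add :: "('a, 'b) monoid_scheme \<Rightarrow> 'a \<Rightarrow> 'a \<Rightarrow> 'a" (infixl \<open>\<oplus>\<index>\<close> 65)
  where "x \<oplus>\<^bsub>S\<^esub> y \<equiv> x \<otimes>\<^bsub>S\<^esub> y"

abbreviation zero :: "('a, 'b) monoid_scheme \<Rightarrow> 'a" (\<open>\<zero>\<index>\<close>)
  where "\<zero>\<^bsub>S\<^esub> \<equiv> \<one>\<^bsub>S\<^esub>"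

abbreviation nsmult :: "('a, 'b) monoid_scheme \<Rightarrow> nat \<Rightarrow> 'a \<Rightarrow> 'a" (\<open>_ \<cdot>\<index> _\<close> [81, 81] 80)
  where "k \<cdot>\<^bsub>S\<^esub> x \<equiv> x [^]\<^bsub>S\<^esub> k"

locale pos_ord_monoid = comm_monoid S for S :: "('a, 'b) ord_monoid_scheme" (structure) +
  assumes leq_refl: "x \<in> carrier S \<Longrightarrow> x \<preceq> x"
    and leq_antisym: "\<lbrakk>x \<in> carrier S; y \<in> carrier S; x \<preceq> y; y \<preceq> x\<rbrakk> \<Longrightarrow> x = y"
    and leq_trans: "\<lbrakk>x \<in> carrier S; y \<in> carrier S; z \<in> carrier S; x \<preceq> y; y \<preceq> z\<rbrakk> \<Longrightarrow> x \<preceq> z"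
    and add_mono: "\<lbrakk>x \<in> carrier S; y \<in> carrier S; z \<in> carrier S; x \<preceq> y\<rbrakk> \<Longrightarrow> x \<oplus> z \<preceq> y \<oplus> z"
    and zero_least: "x \<in> carrier S \<Longrightarrow> \<zero> \<preceq> x"

definition increasing :: "('a, 'b) ord_monoid_scheme \<Rightarrow> (nat \<Rightarrow> 'a) \<Rightarrow> bool"
  where "increasing S f \<longleftrightarrow> (\<forall>n. f n \<in> carrier S \<and> f n \<preceq>\<^bsub>S\<^esub> f (Suc n))"

definition is_sup :: "('a, 'b) ord_monoid_scheme \<Rightarrow> (nat \<Rightarrow> 'a) \<Rightarrow> 'a \<Rightarrow> bool"
  where "is_sup S f s \<longleftrightarrow> s \<in> carrier S \<and> (\<forall>n. f n \<preceq>\<^bsub>S\<^esub> s) \<and>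
    (\<forall>u\<in>carrier S. (\<forall>n. f n \<preceq>\<^bsub>S\<^esub> u) \<longrightarrow> s \<preceq>\<^bsub>S\<^esub> u)"

definition way_below :: "('a, 'b) ord_monoid_scheme \<Rightarrow> 'a \<Rightarrow> 'a \<Rightarrow> bool" (infix \<open>\<lless>\<index>\<close> 50)
  where "x \<lless>\<^bsub>S\<^esub> y \<longleftrightarrow>
    (\<forall>f s. increasing S f \<and> is_sup S f s \<and> y \<preceq>\<^bsub>S\<^esub> s \<longrightarrow> (\<exists>n. x \<preceq>\<^bsub>S\<^esub> f n))"

locale cu_semigroup = pos_ord_monoid S for S :: "('a, 'b) ord_monoid_scheme" (structure) +
  assumes O1: "increasing S f \<Longrightarrow> \<exists>s. is_sup S f s"
    and O2: "x \<in> carrier S \<Longrightarrow>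
      \<exists>f. (\<forall>n. f n \<in> carrier S \<and> f n \<lless> f (Suc n)) \<and> is_sup S f x"
    and O3: "\<lbrakk>x' \<in> carrier S; x \<in> carrier S; y' \<in> carrier S; y \<in> carrier S; x' \<lless> x; y' \<lless> y\<rbrakk>
      \<Longrightarrow> x' \<oplus> y' \<lless> x \<oplus> y"
    and O4: "\<lbrakk>increasing S f; increasing S g; is_sup S f s; is_sup S g t\<rbrakk>
      \<Longrightarrow> is_sup S (\<lambda>n. f n \<oplus> g n) (s \<oplus> t)"

definition axiom_O5 :: "('a, 'b) ord_monoid_scheme \<Rightarrow> bool"
  where "axiom_O5 S \<longleftrightarrow>
    (\<forall>r'\<in>carrier S. \<forall>r\<in>carrier S. \<forall>s'\<in>carrier S. \<forall>s\<in>carrier S. \<forall>t\<in>carrier S.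
      r \<oplus>\<^bsub>S\<^esub> s \<preceq>\<^bsub>S\<^esub> t \<and> r' \<lless>\<^bsub>S\<^esub> r \<and> s' \<lless>\<^bsub>S\<^esub> s \<longrightarrow>
      (\<exists>u\<in>carrier S. r' \<oplus>\<^bsub>S\<^esub> u \<preceq>\<^bsub>S\<^esub> t \<and> t \<preceq>\<^bsub>S\<^esub> r \<oplus>\<^bsub>S\<^esub> u \<and> s' \<lless>\<^bsub>S\<^esub> u))"

definition axiom_O6 :: "('a, 'b) ord_monoid_scheme \<Rightarrow> bool"
  where "axiom_O6 S \<longleftrightarrow>
    (\<forall>x'\<in>carrier S. \<forall>x\<in>carrier S. \<forall>y\<in>carrier S. \<forall>z\<in>carrier S.
      x' \<lless>\<^bsub>S\<^esub> x \<and> x \<preceq>\<^bsub>S\<^esub> y \<oplus>\<^bsub>S\<^esub> z \<longrightarrow>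
      (\<exists>e\<in>carrier S. \<exists>f\<in>carrier S. x' \<preceq>\<^bsub>S\<^esub> e \<oplus>\<^bsub>S\<^esub> f \<and>
        e \<preceq>\<^bsub>S\<^esub> x \<and> e \<preceq>\<^bsub>S\<^esub> y \<and> f \<preceq>\<^bsub>S\<^esub> x \<and> f \<preceq>\<^bsub>S\<^esub> z))"

definition axiom_O7 :: "('a, 'b) ord_monoid_scheme \<Rightarrow> bool"
  where "axiom_O7 S \<longleftrightarrow>
    (\<forall>x1'\<in>carrier S. \<forall>x1\<in>carrier S. \<forall>x2'\<in>carrier S. \<forall>x2\<in>carrier S. \<forall>w\<in>carrier S.
      x1' \<lless>\<^bsub>S\<^esub> x1 \<and> x1 \<preceq>\<^bsub>S\<^esub> w \<and> x2' \<lless>\<^bsub>S\<^esub> x2 \<and> x2 \<preceq>\<^bsub>S\<^esub> w \<longrightarrow>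
      (\<exists>x\<in>carrier S. x1' \<lless>\<^bsub>S\<^esub> x \<and> x2' \<lless>\<^bsub>S\<^esub> x \<and> x \<preceq>\<^bsub>S\<^esub> w \<and> x \<preceq>\<^bsub>S\<^esub> x1 \<oplus>\<^bsub>S\<^esub> x2))"

definition axiom_O8 :: "('a, 'b) ord_monoid_scheme \<Rightarrow> bool"
  where "axiom_O8 S \<longleftrightarrow>
    (\<forall>x'\<in>carrier S. \<forall>x\<in>carrier S. \<forall>y'\<in>carrier S. \<forall>y\<in>carrier S. \<forall>z\<in>carrier S. \<forall>w\<in>carrier S.
      x \<oplus>\<^bsub>S\<^esub> y \<lless>\<^bsub>S\<^esub> z \<oplus>\<^bsub>S\<^esub> w \<and> x' \<lless>\<^bsub>S\<^esub> x \<and> y' \<lless>\<^bsub>S\<^esub> y \<and> 2 \<cdot>\<^bsub>S\<^esub> w = w \<longrightarrow>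
      (\<exists>z1\<in>carrier S. \<exists>z2\<in>carrier S. z1 \<oplus>\<^bsub>S\<^esub> z2 \<lless>\<^bsub>S\<^esub> z \<and>
        x' \<lless>\<^bsub>S\<^esub> z1 \<oplus>\<^bsub>S\<^esub> w \<and> y' \<lless>\<^bsub>S\<^esub> z2 \<oplus>\<^bsub>S\<^esub> w \<and>
        z1 \<lless>\<^bsub>S\<^esub> x \<oplus>\<^bsub>S\<^esub> w \<and> z2 \<lless>\<^bsub>S\<^esub> y \<oplus>\<^bsub>S\<^esub> w))"

locale cu_ideal =
  fixes I :: "'a set" and S :: "('a, 'b) ord_monoid_scheme" (structure)
  assumes ideal_subset: "I \<subseteq> carrier S"
    and ideal_zero: "\<zero> \<in> I"
    and ideal_add: "\<lbrakk>x \<in> I; y \<in> I\<rbrakk> \<Longrightarrow> x \<oplus> y \<in> I"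
    and ideal_sup: "\<lbrakk>increasing S f; range f \<subseteq> I; is_sup S f s\<rbrakk> \<Longrightarrow> s \<in> I"
    and ideal_down: "\<lbrakk>x \<in> carrier S; y \<in> I; x \<preceq> y\<rbrakk> \<Longrightarrow> x \<in> I"

abbreviation ideal_structure ::
    "('a, 'b) ord_monoid_scheme \<Rightarrow> 'a set \<Rightarrow> ('a, 'b) ord_monoid_scheme"
  where "ideal_structure S I \<equiv> S\<lparr>carrier := I\<rparr>"

definition leq_mod :: "('a, 'b) ord_monoid_scheme \<Rightarrow> 'a set \<Rightarrow> 'a \<Rightarrow> 'a \<Rightarrow> bool"
  where "leq_mod S I x y \<longleftrightarrow> (\<exists>w\<in>I. x \<preceq>\<^bsub>S\<^esub> y \<oplus>\<^bsub>S\<^esub> w)"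

definition ideal_rel :: "('a, 'b) ord_monoid_scheme \<Rightarrow> 'a set \<Rightarrow> ('a \<times> 'a) set"
  where "ideal_rel S I =
    {(x, y). x \<in> carrier S \<and> y \<in> carrier S \<and> leq_mod S I x y \<and> leq_mod S I y x}"

text \<open>
  Addition and order on classes are written without choosing representatives;
  \<open>class_add\<close> and \<open>class_leq\<close> below give their values on representatives.
\<close>

definition cu_quotient :: "('a, 'b) ord_monoid_scheme \<Rightarrow> 'a set \<Rightarrow> 'a set ord_monoid"
  where "cu_quotient S I =
    \<lparr>carrier = carrier S // ideal_rel S I,
     mult = (\<lambda>A B. \<Union>x\<in>A. \<Union>y\<in>B. ideal_rel S I `` {x \<oplus>\<^bsub>S\<^esub> y}),
     one = ideal_rel S I `` {\<zero>\<^bsub>S\<^esub>},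
     leq = (\<lambda>A B. \<exists>x\<in>A. \<exists>y\<in>B. leq_mod S I x y)\<rparr>"

definition almost_divisible :: "nat \<Rightarrow> ('a, 'b) ord_monoid_scheme \<Rightarrow> bool"
  where "almost_divisible n S \<longleftrightarrow>
    (\<forall>k::nat. \<forall>x'\<in>carrier S. \<forall>x\<in>carrier S. x' \<lless>\<^bsub>S\<^esub> x \<longrightarrow>
      (\<exists>y\<in>carrier S. k \<cdot>\<^bsub>S\<^esub> y \<preceq>\<^bsub>S\<^esub> x \<and> x' \<preceq>\<^bsub>S\<^esub> ((k + 1) * (n + 1)) \<cdot>\<^bsub>S\<^esub> y))"

context
  fixes S :: "('a, 'b) ord_monoid_scheme" (structure) and I :: "'a set"
  assumes pom: "pos_ord_monoid S" and idl: "cu_ideal I S"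
begin

interpretation pos_ord_monoid S by (rule pom)
interpretation cu_ideal I S by (rule idl)

lemma leq_mod_refl: "x \<in> carrier S \<Longrightarrow> leq_mod S I x x"
  unfolding leq_mod_def using ideal_zero leq_refl by force

lemma leq_mod_add:
  assumes "x \<in> carrier S" "y \<in> carrier S" "x' \<in> carrier S" "y' \<in> carrier S"
    and "leq_mod S I x y" "leq_mod S I x' y'"
  shows "leq_mod S I (x \<oplus> x') (y \<oplus> y')"
proof -
  obtain w w' where w: "w \<in> I" "w' \<in> I" "x \<preceq> y \<oplus> w" "x' \<preceq> y' \<oplus> w'"
    using assms unfolding leq_mod_def by blast
  have c: "w \<in> carrier S" "w' \<in> carrier S" using w ideal_subset by auto
  have 1: "x \<oplus> x' \<preceq> (y \<oplus> w) \<oplus> x'" by (rule add_mono) (use assms w c in auto)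
  have "x' \<oplus> (y \<oplus> w) \<preceq> (y' \<oplus> w') \<oplus> (y \<oplus> w)" by (rule add_mono) (use assms w c in auto)
  then have 2: "(y \<oplus> w) \<oplus> x' \<preceq> (y \<oplus> y') \<oplus> (w \<oplus> w')" using assms c by (simp add: m_ac)
  have "x \<oplus> x' \<preceq> (y \<oplus> y') \<oplus> (w \<oplus> w')" by (rule leq_trans[OF _ _ _ 1 2]) (use assms c in auto)
  then show ?thesis using ideal_add w unfolding leq_mod_def by blast
qed

lemma leq_mod_trans:
  assumes "x \<in> carrier S" "y \<in> carrier S" "z \<in> carrier S"
    and "leq_mod S I x y" "leq_mod S I y z"
  shows "leq_mod S I x z"
proof -
  obtain w w' where w: "w \<in> I" "w' \<in> I" "x \<preceq> y \<oplus> w" "y \<preceq> z \<oplus> w'"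
    using assms unfolding leq_mod_def by blast
  have c: "w \<in> carrier S" "w' \<in> carrier S" using w ideal_subset by auto
  have "y \<oplus> w \<preceq> (z \<oplus> w') \<oplus> w" by (rule add_mono) (use assms w c in auto)
  then have 1: "y \<oplus> w \<preceq> z \<oplus> (w' \<oplus> w)" using assms c by (simp add: m_assoc)
  have "x \<preceq> z \<oplus> (w' \<oplus> w)" by (rule leq_trans[OF _ _ _ w(3) 1]) (use assms c in auto)
  then show ?thesis using ideal_add w unfolding leq_mod_def by blast
qed

lemma equiv_ideal_rel: "equiv (carrier S) (ideal_rel S I)"
  by (auto intro!: equivI refl_onI symI transI intro: leq_mod_refl leq_mod_trans simp: ideal_rel_def)

lemma class_add:
  assumes "x \<in> carrier S" "y \<in> carrier S"
  shows "(ideal_rel S I `` {x}) \<oplus>\<^bsub>cu_quotient S I\<^esub> (ideal_rel S I `` {y}) = ideal_rel S I `` {x \<oplus> y}"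
proof -
  have "(\<lambda>x y. ideal_rel S I `` {x \<oplus> y}) respects2 ideal_rel S I"
    by (rule congruent2I')
      (intro equiv_class_eq[OF equiv_ideal_rel], auto simp: ideal_rel_def intro: leq_mod_add)
  from UN_equiv_class2[OF equiv_ideal_rel equiv_ideal_rel this assms]
  show ?thesis by (simp add: cu_quotient_def)
qed

lemma class_leq:
  assumes "x \<in> carrier S" "y \<in> carrier S"
  shows "(ideal_rel S I `` {x}) \<preceq>\<^bsub>cu_quotient S I\<^esub> (ideal_rel S I `` {y}) \<longleftrightarrow> leq_mod S I x y"
proof
  assume "(ideal_rel S I `` {x}) \<preceq>\<^bsub>cu_quotient S I\<^esub> (ideal_rel S I `` {y})"
  then obtain a b where "(x, a) \<in> ideal_rel S I" "(y, b) \<in> ideal_rel S I" "leq_mod S I a b"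
    by (auto simp: cu_quotient_def)
  then show "leq_mod S I x y"
    unfolding ideal_rel_def by (blast intro: leq_mod_trans)
next
  assume "leq_mod S I x y"
  with assms show "(ideal_rel S I `` {x}) \<preceq>\<^bsub>cu_quotient S I\<^esub> (ideal_rel S I `` {y})"
    by (simp add: cu_quotient_def ideal_rel_def) (blast intro: leq_mod_refl)
qed

end

end

theory Submission
  imports Defs
begin

text \<open>
  Let \<open>x' \<lless> x\<close>. The quotient supplies an element to be multiplied modulo \<open>I\<close>; it is lifted to \<open>S\<close>,
  and what it misses of \<open>x'\<close> lies in \<open>I\<close> and is divided there. The difficulty is that the divisor
  from the quotient and the divisor from \<open>I\<close> must fit into \<open>x\<close> side by side. The factor \<open>2\<close> in the
  bound pays for this, once on each side.

  On the quotient side, one divides by \<open>2k\<close> instead of \<open>k\<close>. Passing to \<open>S/I\<close> preserves compact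
  containment (\<open>way_below_quotient\<close>), so there are \<open>y\<close> and an idempotent \<open>w\<close> of \<open>I\<close> with
  \<open>2k y \<le> x + w\<close> and \<open>x' \<le> (2k+1)(n\<^sub>1+1) y + w\<close>. Axiom (O8) splits \<open>x\<close> into \<open>2k\<close> summands each of
  which is \<open>y\<close> up to \<open>w\<close>, and (O6) finds below all of them a single element that is still \<open>y\<close> up to
  \<open>w\<close> (\<open>lift_multiple_mod_idempotent\<close>). Hence one gets \<open>z\<close> with \<open>2k z \<le> x\<close> and
  \<open>x' \<le> (2k+1)(n\<^sub>1+1) z + w\<close>.

  Next, \<open>kz\<close> is complemented in \<open>x\<close>. As a second copy of \<open>kz\<close> fits into \<open>x\<close>, axiom (O5) yields a
  complement \<open>u\<close> that dominates \<open>kz\<close> itself, up to replacing \<open>z\<close> by elements compactly contained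
  in it. So \<open>kz + u \<le> x \<le> kz + u \<le> 2u\<close> up to such replacements (\<open>half_complement\<close>). A complement
  for which only \<open>x \<le> kz + u\<close> is known would not do: the part of \<open>x'\<close> in \<open>I\<close> that lies below \<open>z\<close>,
  but not below the smaller element actually split off, would escape both divisors.

  By (O6), \<open>x' \<le> e + f\<close> with \<open>e \<le> (2k+1)(n\<^sub>1+1) z\<close> and \<open>f \<in> I\<close>, \<open>f \<le> x \<le> 2u\<close>. By (O6) and (O7),
  \<open>f \<le> 2g\<close> for some \<open>g \<in> I\<close> with \<open>g \<le> u\<close>, again up to compact containment
  (\<open>ideal_part_below_half\<close>). Dividing \<open>g\<close> in \<open>I\<close> gives \<open>v\<close> with \<open>kv \<le> g \<le> u\<close> and
  \<open>g \<le> (k+1)(n\<^sub>2+1) v\<close>. Then \<open>k(z + v) \<le> kz + u \<le> x\<close>, and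
  \<open>x' \<le> (2k+1)(n\<^sub>1+1) z + 2(k+1)(n\<^sub>2+1) v\<close>, where both coefficients are at most
  \<open>(k+1) max (2n\<^sub>1+2) (2n\<^sub>2+2)\<close>.
\<close>

section \<open>Order and compact containment\<close>

context pos_ord_monoid
begin

lemma add_mono2:
  assumes "x \<in> carrier S" "y \<in> carrier S" "x' \<in> carrier S" "y' \<in> carrier S"
    and "x \<preceq> y" "x' \<preceq> y'"
  shows "x \<oplus> x' \<preceq> y \<oplus> y'"
proof -
  have 1: "x \<oplus> x' \<preceq> y \<oplus> x'" using assms by (intro add_mono) auto
  have "x' \<oplus> y \<preceq> y' \<oplus> y" using assms by (intro add_mono) auto
  then have 2: "y \<oplus> x' \<preceq> y \<oplus> y'" using assms by (simp add: m_comm)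
  show ?thesis by (rule leq_trans[OF _ _ _ 1 2]) (use assms in auto)
qed

lemma leq_add_right:
  assumes "x \<in> carrier S" "y \<in> carrier S"
  shows "x \<preceq> x \<oplus> y"
  using add_mono2[of x x \<zero> y] assms by (simp add: leq_refl zero_least)

lemma leq_add_left:
  assumes "x \<in> carrier S" "y \<in> carrier S"
  shows "x \<preceq> y \<oplus> x"
  using leq_add_right[OF assms] assms by (simp add: m_comm)

lemma nsmult_mono:
  assumes "x \<in> carrier S" "y \<in> carrier S" "x \<preceq> y"
  shows "n \<cdot> x \<preceq> n \<cdot> y"
  using assms by (induction n) (auto intro: add_mono2 leq_refl)

lemma nsmult_mono_left:
  assumes "x \<in> carrier S" "m \<le> n"
  shows "m \<cdot> x \<preceq> n \<cdot> x"
  using leq_add_right[of "m \<cdot> x" "(n - m) \<cdot> x"] assms by (simp add: nat_pow_mult)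

lemma nsmult_idempotent_leq:
  assumes "w \<in> carrier S" "w \<oplus> w = w"
  shows "n \<cdot> w \<preceq> w"
proof (induction n)
  case 0
  then show ?case using assms by (simp add: zero_least)
next
  case (Suc n)
  then show ?case using add_mono[of "n \<cdot> w" w w] assms by simp
qed

lemma increasing_const: "x \<in> carrier S \<Longrightarrow> increasing S (\<lambda>n. x)"
  by (simp add: increasing_def leq_refl)

lemma is_sup_const: "x \<in> carrier S \<Longrightarrow> is_sup S (\<lambda>n. x) x"
  by (simp add: is_sup_def leq_refl)

lemma increasing_add:
  "increasing S f \<Longrightarrow> increasing S g \<Longrightarrow> increasing S (\<lambda>n. f n \<oplus> g n)"
  by (simp add: increasing_def add_mono2)

lemma increasing_nsmult: "increasing S f \<Longrightarrow> increasing S (\<lambda>n. k \<cdot> f n)"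
  by (simp add: increasing_def nsmult_mono)

lemma way_belowD:
  assumes "a \<lless> b" "b \<preceq> s" "increasing S f" "is_sup S f s"
  shows "\<exists>n. a \<preceq> f n"
  using assms unfolding way_below_def by blast

lemma way_below_leq:
  assumes "a \<lless> b" "b \<in> carrier S"
  shows "a \<preceq> b"
  using way_belowD[OF assms(1) leq_refl increasing_const is_sup_const] assms by blast

lemma way_below_leq_trans:
  assumes "a \<lless> b" "b \<preceq> c" "b \<in> carrier S" "c \<in> carrier S"
  shows "a \<lless> c"
  unfolding way_below_def
proof (intro allI impI, elim conjE)
  fix f s
  assume f: "increasing S f" "is_sup S f s" and "c \<preceq> s"
  then have "b \<preceq> s" using leq_trans[OF assms(3,4) _ assms(2)] by (simp add: is_sup_def)
  then show "\<exists>n. a \<preceq> f n" using way_belowD[OF assms(1) _ f] by blast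
qed

lemma leq_way_below_trans:
  assumes "a \<preceq> b" "b \<lless> c" "a \<in> carrier S" "b \<in> carrier S"
  shows "a \<lless> c"
  unfolding way_below_def
proof (intro allI impI, elim conjE)
  fix f s
  assume f: "increasing S f" "is_sup S f s" and "c \<preceq> s"
  then obtain n where "b \<preceq> f n" using way_belowD[OF assms(2) _ f] by blast
  then have "a \<preceq> f n" using leq_trans[OF assms(3,4) _ assms(1)] f by (simp add: increasing_def)
  then show "\<exists>n. a \<preceq> f n" by blast
qed

end

context cu_semigroup
begin

lemma way_below_interpolate:
  assumes "a \<lless> b" "a \<in> carrier S" "b \<in> carrier S"
  obtains c where "c \<in> carrier S" "a \<lless> c" "c \<lless> b"
proof -
  obtain f where f: "\<And>n. f n \<in> carrier S" "\<And>n. f n \<lless> f (Suc n)" "is_sup S f b"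
    using O2[OF assms(3)] by blast
  have inc: "increasing S f" using f by (simp add: increasing_def way_below_leq)
  obtain n where n: "a \<preceq> f n"
    using way_belowD[OF assms(1) leq_refl[OF assms(3)] inc f(3)] by blast
  have "f (Suc (Suc n)) \<preceq> b" using f(3) by (simp add: is_sup_def)
  then have "f (Suc n) \<lless> b" using way_below_leq_trans[OF f(2)] f(1) assms by simp
  moreover have "a \<lless> f (Suc n)" using leq_way_below_trans[OF n f(2)] assms f by blast
  ultimately show thesis using that f(1) by blast
qed

lemma nsmult_way_below:
  assumes "a \<lless> b" "a \<in> carrier S" "b \<in> carrier S"
  shows "n \<cdot> a \<lless> n \<cdot> b"
proof (induction n)
  case 0
  show ?case by (simp add: way_below_def increasing_def zero_least)
next
  case (Suc n)
  then show ?case using assms by (simp add: O3)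
qed

lemma is_sup_nsmult:
  assumes "increasing S f" "is_sup S f s"
  shows "is_sup S (\<lambda>n. k \<cdot> f n) (k \<cdot> s)"
proof (induction k)
  case 0
  then show ?case by (simp add: is_sup_const)
next
  case (Suc k)
  then show ?case using O4[OF increasing_nsmult[OF assms(1)] assms(1) _ assms(2)] by simp
qed

text \<open>
  By (O4) and (O2), \<open>q \<cdot> y \<oplus> w\<close> is the supremum of the elements \<open>q \<cdot> y' \<oplus> w\<close> for a sequence of
  \<open>y' \<lless> y\<close>. This is how room is made in \<open>y\<close> at the expense of shrinking the left-hand side.
\<close>

lemma way_below_approx:
  assumes "a \<lless> b" "b \<preceq> q \<cdot> y \<oplus> w"
    and "y \<in> carrier S" "w \<in> carrier S"
  obtains y' where "y' \<in> carrier S" "y' \<lless> y" "a \<preceq> q \<cdot> y' \<oplus> w"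
proof -
  obtain f where f: "\<And>n. f n \<in> carrier S" "\<And>n. f n \<lless> f (Suc n)" "is_sup S f y"
    using O2[OF assms(3)] by blast
  have inc: "increasing S f" using f by (simp add: increasing_def way_below_leq)
  have "is_sup S (\<lambda>n. q \<cdot> f n \<oplus> w) (q \<cdot> y \<oplus> w)"
    using O4[OF increasing_nsmult[OF inc] increasing_const is_sup_nsmult[OF inc f(3)] is_sup_const]
      assms by blast
  moreover have "increasing S (\<lambda>n. q \<cdot> f n \<oplus> w)"
    using increasing_add[OF increasing_nsmult[OF inc] increasing_const] assms by blast
  ultimately obtain n where n: "a \<preceq> q \<cdot> f n \<oplus> w"
    using way_belowD[OF assms(1,2)] by blast
  have "f (Suc n) \<preceq> y" using f(3) by (simp add: is_sup_def)
  then have "f n \<lless> y" using way_below_leq_trans[OF f(2)] f(1) assms by simp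
  then show thesis using that n f by blast
qed

corollary way_below_approx_add:
  assumes "a \<lless> b" "b \<preceq> y \<oplus> w" "y \<in> carrier S" "w \<in> carrier S"
  obtains y' where "y' \<in> carrier S" "y' \<lless> y" "a \<preceq> y' \<oplus> w"
  using way_below_approx[where q = 1, OF assms(1) _ assms(3,4)] assms by auto

text \<open>
  The elements compactly contained in \<open>c\<close> are upward directed, since \<open>c\<close> is the supremum of a
  \<open>\<lless>\<close>-increasing sequence.
\<close>

lemma way_below_approx2:
  assumes "a \<lless> c" "b \<lless> c" "a \<in> carrier S" "b \<in> carrier S" "c \<in> carrier S"
  obtains c' where "c' \<in> carrier S" "c' \<lless> c" "a \<preceq> c'" "b \<preceq> c'"
proof -
  obtain f where f: "\<And>n. f n \<in> carrier S" "\<And>n. f n \<lless> f (Suc n)" "is_sup S f c"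
    using O2[OF assms(5)] by blast
  have inc: "increasing S f" using f by (simp add: increasing_def way_below_leq)
  have mono: "f i \<preceq> f (i + j)" for i j
  proof (induction j)
    case 0
    show ?case using f by (simp add: leq_refl)
  next
    case (Suc j)
    then show ?case using leq_trans[OF _ _ _ Suc way_below_leq[OF f(2)]] f(1) by simp
  qed
  obtain i where i: "a \<preceq> f i"
    using way_belowD[OF assms(1) leq_refl[OF assms(5)] inc f(3)] by blast
  obtain j where j: "b \<preceq> f j"
    using way_belowD[OF assms(2) leq_refl[OF assms(5)] inc f(3)] by blast
  have "f i \<preceq> f (i + j)" "f j \<preceq> f (i + j)" using mono[of i j] mono[of j i] by (simp_all add: add.commute)
  then have "a \<preceq> f (i + j)" "b \<preceq> f (i + j)"
    using leq_trans[OF _ _ _ i] leq_trans[OF _ _ _ j] assms f(1) by simp_all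
  moreover have "f (Suc (i + j)) \<preceq> c" using f(3) by (simp add: is_sup_def)
  then have "f (i + j) \<lless> c" using way_below_leq_trans[OF f(2)] f(1) assms by simp
  ultimately show thesis using that f(1) by blast
qed

section \<open>Idempotents in an ideal and the quotient\<close>

text \<open>
  The supremum \<open>\<infinity>p\<close> of all multiples of \<open>p\<close> is idempotent by (O4). Replacing error terms
  in \<open>I\<close> by idempotents keeps them from growing when inequalities modulo \<open>I\<close> are combined, and is
  required for applying (O8).
\<close>

lemma ideal_idempotent_above:
  assumes I: "cu_ideal I S" and p: "p \<in> I"
  obtains w where "w \<in> I" "w \<oplus> w = w" "p \<preceq> w"
proof -
  interpret cu_ideal I S by (rule I)
  have pc: "p \<in> carrier S" using p ideal_subset by blast
  have pI: "n \<cdot> p \<in> I" for n :: nat using p by (induction n) (auto simp: ideal_zero ideal_add)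
  have inc: "increasing S (\<lambda>n::nat. n \<cdot> p)"
    using pc by (auto simp: increasing_def leq_add_right)
  obtain w where w: "is_sup S (\<lambda>n::nat. n \<cdot> p) w" using O1[OF inc] by blast
  have wI: "w \<in> I" using ideal_sup[OF inc _ w] pI by blast
  have wc: "w \<in> carrier S" using wI ideal_subset by blast
  have up: "n \<cdot> p \<preceq> w" for n :: nat using w by (simp add: is_sup_def)
  have "is_sup S (\<lambda>n::nat. n \<cdot> p \<oplus> n \<cdot> p) (w \<oplus> w)" using O4[OF inc inc w w] .
  then have "w \<oplus> w \<preceq> w" using up wc pc by (auto simp: is_sup_def nat_pow_mult)
  then have "w \<oplus> w = w" using leq_add_right wc leq_antisym by blast
  then show thesis using that wI up[of 1] pc by simp
qed

text \<open>
  The bound is the supremum of the partial sums.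
\<close>

lemma ideal_sequence_bound:
  assumes I: "cu_ideal I S" and p: "\<And>n::nat. p n \<in> I"
  obtains w where "w \<in> I" "\<And>n. p n \<preceq> w"
proof -
  interpret cu_ideal I S by (rule I)
  have pc: "p n \<in> carrier S" for n using p ideal_subset by blast
  define f where "f = rec_nat (p 0) (\<lambda>n a. a \<oplus> p (Suc n))"
  have f: "f 0 = p 0" "f (Suc n) = f n \<oplus> p (Suc n)" for n by (simp_all add: f_def)
  have fI: "f n \<in> I" for n using p by (induction n) (auto simp: f ideal_add)
  then have fc: "f n \<in> carrier S" for n using ideal_subset by blast
  have inc: "increasing S f" using fc pc by (simp add: increasing_def f leq_add_right)
  obtain w where w: "is_sup S f w" using O1[OF inc] by blast
  have wI: "w \<in> I" using ideal_sup[OF inc _ w] fI by blast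
  have "p n \<preceq> f n" for n using fc pc by (cases n) (simp_all add: f leq_refl leq_add_left)
  moreover have "f n \<preceq> w" for n using w by (simp add: is_sup_def)
  moreover have "w \<in> carrier S" using wI ideal_subset by blast
  ultimately show thesis using that wI leq_trans[OF pc fc] by blast
qed

text \<open>
  An increasing sequence of classes need not lift to an increasing sequence of representatives
  \<open>y n\<close>, but only countably many error terms occur. After adding one idempotent \<open>w \<in> I\<close> above all of
  them, \<open>y n \<oplus> w\<close> does increase, and its supremum \<open>t\<close> in \<open>S\<close> represents an upper bound of the
  classes. Now \<open>x' \<lless> x\<close> can be tested on the sequence \<open>y n \<oplus> w \<oplus> q\<close> in \<open>S\<close>, where \<open>q\<close> is the
  error in \<open>x \<preceq> t \<oplus> q\<close>.
\<close>

lemma way_below_quotient: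
  assumes I: "cu_ideal I S" and wb: "x' \<lless> x" and x: "x' \<in> carrier S" "x \<in> carrier S"
  shows "(ideal_rel S I `` {x'}) \<lless>\<^bsub>cu_quotient S I\<^esub> (ideal_rel S I `` {x})"
  unfolding way_below_def
proof (intro allI impI, elim conjE)
  fix F T
  assume inc: "increasing (cu_quotient S I) F" and sup: "is_sup (cu_quotient S I) F T"
    and le: "(ideal_rel S I `` {x}) \<preceq>\<^bsub>cu_quotient S I\<^esub> T"
  interpret cu_ideal I S by (rule I)
  note class_leq = class_leq[OF pos_ord_monoid_axioms I]
  have rep: "\<exists>y\<in>carrier S. A = ideal_rel S I `` {y}" if "A \<in> carrier (cu_quotient S I)" for A
    using that by (auto simp: cu_quotient_def elim: quotientE)
  have cls: "ideal_rel S I `` {y} \<in> carrier (cu_quotient S I)" if "y \<in> carrier S" for y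
    using that by (auto simp: cu_quotient_def intro: quotientI)
  have "\<forall>n. \<exists>y\<in>carrier S. F n = ideal_rel S I `` {y}"
    using inc rep unfolding increasing_def by blast
  then obtain y where y: "\<And>n. y n \<in> carrier S" "\<And>n. F n = ideal_rel S I `` {y n}" by metis
  obtain s where s: "s \<in> carrier S" "T = ideal_rel S I `` {s}"
    using rep sup unfolding is_sup_def by blast
  have "leq_mod S I (y n) (y (Suc n))" for n
    using inc class_leq[OF y(1) y(1), of n "Suc n"] by (simp add: increasing_def y(2))
  then have "\<exists>p\<in>I. y n \<preceq> y (Suc n) \<oplus> p" for n by (simp add: leq_mod_def)
  then obtain p where p: "\<And>n. p n \<in> I" "\<And>n. y n \<preceq> y (Suc n) \<oplus> p n" by metis
  obtain v where v: "v \<in> I" "\<And>n. p n \<preceq> v" using ideal_sequence_bound[where p = p, OF I p(1)] by blast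
  obtain w where w: "w \<in> I" "w \<oplus> w = w" "v \<preceq> w" using ideal_idempotent_above[OF I v(1)] .
  have c: "p n \<in> carrier S" "v \<in> carrier S" "w \<in> carrier S" for n
    using p v w ideal_subset by auto
  have incy: "increasing S (\<lambda>n. y n \<oplus> w)"
    unfolding increasing_def
  proof (intro allI conjI)
    fix n
    show "y n \<oplus> w \<in> carrier S" using y c by simp
    have 1: "y n \<oplus> w \<preceq> (y (Suc n) \<oplus> p n) \<oplus> w" using p y c by (intro add_mono) auto
    have "p n \<preceq> w" using leq_trans[OF _ _ _ v(2) w(3)] c by blast
    then have "(y (Suc n) \<oplus> p n) \<oplus> w \<preceq> (y (Suc n) \<oplus> w) \<oplus> w"
      using y c by (intro add_mono2) (auto simp: leq_refl)
    also have "(y (Suc n) \<oplus> w) \<oplus> w = y (Suc n) \<oplus> w" using y c w by (simp add: m_assoc)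
    finally show "y n \<oplus> w \<preceq> y (Suc n) \<oplus> w" using leq_trans[OF _ _ _ 1] y c by simp
  qed
  obtain t where t: "is_sup S (\<lambda>n. y n \<oplus> w) t" using O1[OF incy] by blast
  have tc: "t \<in> carrier S" using t by (simp add: is_sup_def)
  have "leq_mod S I (y n) t" for n
  proof -
    have "y n \<oplus> w \<preceq> t" using t by (simp add: is_sup_def)
    moreover have "y n \<preceq> y n \<oplus> w" using y c leq_add_right by blast
    moreover have "t \<preceq> t \<oplus> w" using tc c leq_add_right by blast
    ultimately have "y n \<preceq> t \<oplus> w"
      using leq_trans[of "y n" "y n \<oplus> w" t] leq_trans[of "y n" t "t \<oplus> w"] y c tc by simp
    then show ?thesis using w unfolding leq_mod_def by blast
  qed
  then have "F n \<preceq>\<^bsub>cu_quotient S I\<^esub> ideal_rel S I `` {t}" for n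
    using class_leq y tc by simp
  then have "T \<preceq>\<^bsub>cu_quotient S I\<^esub> ideal_rel S I `` {t}"
    using sup cls[OF tc] unfolding is_sup_def by blast
  then have "leq_mod S I s t" using class_leq s tc by simp
  moreover have "leq_mod S I x s" using le s class_leq x by simp
  ultimately have "leq_mod S I x t"
    using leq_mod_trans[OF pos_ord_monoid_axioms I] x s tc by blast
  then obtain q where q: "q \<in> I" "x \<preceq> t \<oplus> q" unfolding leq_mod_def by blast
  have qc: "q \<in> carrier S" using q ideal_subset by blast
  have "is_sup S (\<lambda>n. (y n \<oplus> w) \<oplus> q) (t \<oplus> q)"
    using O4[OF incy increasing_const[OF qc] t is_sup_const[OF qc]] .
  then obtain n where "x' \<preceq> (y n \<oplus> w) \<oplus> q"
    using way_belowD[OF wb q(2) increasing_add[OF incy increasing_const[OF qc]]] by blast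
  then have "x' \<preceq> y n \<oplus> (w \<oplus> q)" using y c qc by (simp add: m_assoc)
  then have "leq_mod S I x' (y n)" using w q ideal_add unfolding leq_mod_def by blast
  then have "(ideal_rel S I `` {x'}) \<preceq>\<^bsub>cu_quotient S I\<^esub> F n" using class_leq x y by simp
  then show "\<exists>n. (ideal_rel S I `` {x'}) \<preceq>\<^bsub>cu_quotient S I\<^esub> F n" by blast
qed

text \<open>
  Suprema of sequences in \<open>I\<close> are the same in \<open>I\<close> and in \<open>S\<close>, because \<open>I\<close> is closed under them.
\<close>

lemma way_below_ideal:
  assumes I: "cu_ideal I S" and "a \<lless> b" "b \<in> I"
  shows "a \<lless>\<^bsub>ideal_structure S I\<^esub> b"
  unfolding way_below_def
proof (intro allI impI, elim conjE)
  fix f s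
  assume f: "increasing (ideal_structure S I) f" "is_sup (ideal_structure S I) f s"
    and b: "b \<preceq>\<^bsub>ideal_structure S I\<^esub> s"
  interpret cu_ideal I S by (rule I)
  have fI: "range f \<subseteq> I" and inc: "increasing S f"
    using f ideal_subset by (auto simp: increasing_def)
  obtain t where t: "is_sup S f t" using O1[OF inc] by blast
  have "t \<in> I" using ideal_sup[OF inc fI t] .
  then have "s \<preceq> t" using f t by (simp add: is_sup_def)
  moreover have "s \<in> I" using f by (simp add: is_sup_def)
  ultimately have "b \<preceq> t" using b assms \<open>t \<in> I\<close> ideal_subset leq_trans[of b s t] by auto
  then show "\<exists>n. a \<preceq>\<^bsub>ideal_structure S I\<^esub> f n"
    using way_belowD[OF assms(2) _ inc t] by simp
qed

lemma class_nsmult: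
  assumes I: "cu_ideal I S" and y: "y \<in> carrier S"
  shows "n \<cdot>\<^bsub>cu_quotient S I\<^esub> (ideal_rel S I `` {y}) = ideal_rel S I `` {n \<cdot> y}"
proof (induction n)
  case 0
  then show ?case by (simp add: nat_pow_def cu_quotient_def)
next
  case (Suc n)
  have "(Suc n) \<cdot>\<^bsub>cu_quotient S I\<^esub> (ideal_rel S I `` {y})
    = (n \<cdot>\<^bsub>cu_quotient S I\<^esub> (ideal_rel S I `` {y})) \<oplus>\<^bsub>cu_quotient S I\<^esub> (ideal_rel S I `` {y})"
    by (simp add: nat_pow_def)
  then show ?case using Suc class_add[OF pos_ord_monoid_axioms I nat_pow_closed[OF y] y] by simp
qed

text \<open>
  Almost divisibility of the quotient, expressed by representatives. Both inequalities can use
  the same error term, namely an idempotent above the sum of the two.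
\<close>

lemma quotient_almost_divisibleE:
  assumes I: "cu_ideal I S" and div: "almost_divisible n (cu_quotient S I)"
    and wb: "x' \<lless> x" and x: "x' \<in> carrier S" "x \<in> carrier S"
  obtains y w where "y \<in> carrier S" "w \<in> I" "w \<oplus> w = w"
    "k \<cdot> y \<preceq> x \<oplus> w" "x' \<preceq> ((k + 1) * (n + 1)) \<cdot> y \<oplus> w"
proof -
  interpret cu_ideal I S by (rule I)
  have cls: "ideal_rel S I `` {y} \<in> carrier (cu_quotient S I)" if "y \<in> carrier S" for y
    using that by (auto simp: cu_quotient_def intro: quotientI)
  obtain Y where Y: "Y \<in> carrier (cu_quotient S I)"
    "k \<cdot>\<^bsub>cu_quotient S I\<^esub> Y \<preceq>\<^bsub>cu_quotient S I\<^esub> ideal_rel S I `` {x}"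
    "ideal_rel S I `` {x'} \<preceq>\<^bsub>cu_quotient S I\<^esub> ((k + 1) * (n + 1)) \<cdot>\<^bsub>cu_quotient S I\<^esub> Y"
    using div way_below_quotient[OF I wb x] cls[OF x(1)] cls[OF x(2)]
    unfolding almost_divisible_def by blast
  obtain y where y: "y \<in> carrier S" "Y = ideal_rel S I `` {y}"
    using Y(1) by (auto simp: cu_quotient_def elim: quotientE)
  have "leq_mod S I (k \<cdot> y) x" "leq_mod S I x' (((k + 1) * (n + 1)) \<cdot> y)"
    using Y y x by (simp_all only: class_nsmult[OF I] class_leq[OF pos_ord_monoid_axioms I] nat_pow_closed)
  then obtain p q where pq: "p \<in> I" "q \<in> I" "k \<cdot> y \<preceq> x \<oplus> p" "x' \<preceq> ((k + 1) * (n + 1)) \<cdot> y \<oplus> q"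
    unfolding leq_mod_def by blast
  obtain w where w: "w \<in> I" "w \<oplus> w = w" "p \<oplus> q \<preceq> w"
    using ideal_idempotent_above[OF I ideal_add[OF pq(1,2)]] by blast
  have c: "p \<in> carrier S" "q \<in> carrier S" "w \<in> carrier S" using pq w ideal_subset by auto
  have pw: "p \<preceq> w" and qw: "q \<preceq> w"
    using leq_trans[OF _ _ _ leq_add_right w(3)] leq_trans[OF _ _ _ leq_add_left w(3)] c by auto
  have up: "a \<preceq> b \<oplus> w" if "a \<preceq> b \<oplus> r" "r \<preceq> w" "a \<in> carrier S" "b \<in> carrier S" "r \<in> carrier S" for a b r
    using leq_trans[OF _ _ _ that(1) add_mono2[of b b r w]] that c leq_refl by simp
  show thesis
    by (rule that[OF y(1) w(1,2)]) (rule up[OF pq(3) pw] up[OF pq(4) qw]; use x y c in simp)+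
qed

section \<open>Lifting multiples from the quotient\<close>

text \<open>
  Apply (O6) to \<open>y \<preceq> a \<oplus> w\<close> to get a part \<open>e\<close> of \<open>y\<close> below \<open>a\<close>. Since \<open>e \<preceq> y \<preceq> b \<oplus> w\<close>, a second use
  of (O6) cuts \<open>e\<close> down to a part \<open>z\<close> below \<open>b\<close>. Each time only a summand below \<open>w\<close> is lost, and
  \<open>w\<close> absorbs both.
\<close>

lemma common_lower_bound_mod_idempotent:
  assumes O6: "axiom_O6 S"
    and wb: "y' \<lless> y" and le: "y \<preceq> a \<oplus> w" "y \<preceq> b \<oplus> w" and w: "w \<oplus> w = w"
    and c: "y' \<in> carrier S" "y \<in> carrier S" "a \<in> carrier S" "b \<in> carrier S" "w \<in> carrier S"
  obtains z where "z \<in> carrier S" "z \<preceq> a" "z \<preceq> b" "y' \<preceq> z \<oplus> w"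
proof -
  obtain y1 where y1: "y1 \<in> carrier S" "y' \<lless> y1" "y1 \<lless> y"
    using way_below_interpolate[OF wb c(1,2)] .
  obtain e f where ef: "e \<in> carrier S" "f \<in> carrier S" "y1 \<preceq> e \<oplus> f" "e \<preceq> y" "e \<preceq> a" "f \<preceq> w"
    using O6[unfolded axiom_O6_def, rule_format, of y1 y a w] y1 le c by auto
  obtain e' where e': "e' \<in> carrier S" "e' \<lless> e" "y' \<preceq> e' \<oplus> f"
    using way_below_approx_add[OF y1(2) ef(3,1,2)] .
  have "e \<preceq> b \<oplus> w" using leq_trans[OF _ _ _ ef(4) le(2)] ef c by simp
  then obtain z g where zg: "z \<in> carrier S" "g \<in> carrier S" "e' \<preceq> z \<oplus> g" "z \<preceq> e" "z \<preceq> b" "g \<preceq> w"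
    using O6[unfolded axiom_O6_def, rule_format, of e' e b w] e' ef c by auto
  have "z \<preceq> a" using leq_trans[OF _ _ _ zg(4) ef(5)] zg ef c by simp
  moreover have "y' \<preceq> z \<oplus> w"
  proof -
    have "e' \<oplus> f \<preceq> (z \<oplus> g) \<oplus> f" using e' ef zg by (intro add_mono) auto
    moreover have "(z \<oplus> g) \<oplus> f \<preceq> (z \<oplus> w) \<oplus> w"
      using zg ef c by (intro add_mono2) (auto simp: leq_refl)
    moreover have "(z \<oplus> w) \<oplus> w = z \<oplus> w" using zg c w by (simp add: m_assoc)
    ultimately have "e' \<oplus> f \<preceq> z \<oplus> w"
      using leq_trans[of "e' \<oplus> f" "(z \<oplus> g) \<oplus> f" "z \<oplus> w"] e' zg ef c by simp
    then show ?thesis using leq_trans[OF _ _ _ e'(3)] e' zg ef c by simp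
  qed
  ultimately show thesis using that zg by blast
qed

text \<open>
  Each induction step applies (O8) to \<open>m \<cdot> y \<oplus> y \<lless> x \<oplus> w\<close>: \<open>x\<close> contains \<open>z1 \<oplus> z2\<close>, where modulo
  \<open>w\<close> the element \<open>z1\<close> contains \<open>m\<close> copies of \<open>y\<close> and \<open>z2\<close> contains one. The induction hypothesis
  makes the \<open>m\<close> copies in \<open>z1\<close> equal, say to \<open>z'\<close>, and a common part of \<open>z'\<close> and \<open>z2\<close> then serves
  for all \<open>m + 1\<close> copies.
\<close>

lemma lift_multiple_mod_idempotent:
  assumes O6: "axiom_O6 S" and O8: "axiom_O8 S"
    and w: "w \<in> carrier S" "w \<oplus> w = w"
    and "m \<cdot> y \<lless> x \<oplus> w" "y' \<lless> y" "y' \<in> carrier S" "y \<in> carrier S" "x \<in> carrier S"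
  shows "\<exists>z\<in>carrier S. m \<cdot> z \<preceq> x \<and> y' \<preceq> z \<oplus> w"
  using assms(5-)
proof (induction m arbitrary: x y y')
  case 0
  then show ?case using leq_add_right w by (auto simp: zero_least)
next
  case (Suc m)
  note c = Suc.prems(3-5)
  obtain y1 where y1: "y1 \<in> carrier S" "y' \<lless> y1" "y1 \<lless> y"
    using way_below_interpolate[OF Suc.prems(2) c(1,2)] .
  obtain y2 where y2: "y2 \<in> carrier S" "y1 \<lless> y2" "y2 \<lless> y"
    using way_below_interpolate[OF y1(3,1) c(2)] .
  have "m \<cdot> y \<oplus> y \<lless> x \<oplus> w" using Suc.prems(1) by simp
  moreover have "m \<cdot> y2 \<lless> m \<cdot> y" using nsmult_way_below y2 c by blast
  moreover have "2 \<cdot> w = w" using w by (simp add: numeral_2_eq_2)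
  ultimately obtain z1 z2 where z: "z1 \<in> carrier S" "z2 \<in> carrier S" "z1 \<oplus> z2 \<lless> x"
    "m \<cdot> y2 \<lless> z1 \<oplus> w" "y2 \<lless> z2 \<oplus> w"
    using O8[unfolded axiom_O8_def, rule_format, of "m \<cdot> y2" "m \<cdot> y" y2 y x w] y2 c w by auto
  obtain z' where z': "z' \<in> carrier S" "m \<cdot> z' \<preceq> z1" "y1 \<preceq> z' \<oplus> w"
    using Suc.IH[OF z(4) y2(2) y1(1) y2(1) z(1)] by blast
  have "y1 \<lless> z2 \<oplus> w" using leq_way_below_trans[OF way_below_leq[OF y2(2)] z(5)] y1 y2 by blast
  then have "y1 \<preceq> z2 \<oplus> w" using way_below_leq z w by simp
  then obtain v where v: "v \<in> carrier S" "v \<preceq> z'" "v \<preceq> z2" "y' \<preceq> v \<oplus> w"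
    using common_lower_bound_mod_idempotent[OF O6 y1(2) z'(3) _ w(2)] c y1 z z' w by metis
  have "m \<cdot> v \<preceq> z1" using leq_trans[OF _ _ _ nsmult_mono z'(2)] v z z' by simp
  then have "m \<cdot> v \<oplus> v \<preceq> z1 \<oplus> z2" using v z by (intro add_mono2) auto
  then have "Suc m \<cdot> v \<preceq> x"
    using leq_trans[OF _ _ _ _ way_below_leq[OF z(3)]] v z c by simp
  then show ?case using v by blast
qed

text \<open>
  The inequality \<open>k \<cdot> z \<preceq> x\<close> now holds exactly, without an error in \<open>I\<close>. Only the upper estimate
  of \<open>x'\<close> remains modulo \<open>I\<close>.
\<close>

lemma quotient_almost_divisible_lift:
  assumes O6: "axiom_O6 S" and O8: "axiom_O8 S"
    and I: "cu_ideal I S" and div: "almost_divisible n (cu_quotient S I)"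
    and wb: "x' \<lless> x" and x: "x' \<in> carrier S" "x \<in> carrier S"
  obtains z w where "z \<in> carrier S" "w \<in> I"
    "k \<cdot> z \<preceq> x" "x' \<preceq> ((k + 1) * (n + 1)) \<cdot> z \<oplus> w"
proof -
  interpret cu_ideal I S by (rule I)
  define q where "q = (k + 1) * (n + 1)"
  obtain x1 where x1: "x1 \<in> carrier S" "x' \<lless> x1" "x1 \<lless> x"
    using way_below_interpolate[OF wb x] .
  obtain y w where y: "y \<in> carrier S" and w: "w \<in> I" "w \<oplus> w = w"
    and yx: "k \<cdot> y \<preceq> x \<oplus> w" and xy: "x1 \<preceq> q \<cdot> y \<oplus> w"
    using quotient_almost_divisibleE[OF I div x1(3,1) x(2), of k] unfolding q_def .
  have wc: "w \<in> carrier S" using w ideal_subset by blast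
  obtain y' where y': "y' \<in> carrier S" "y' \<lless> y" "x' \<preceq> q \<cdot> y' \<oplus> w"
    using way_below_approx[OF x1(2) xy y wc] .
  obtain y2 where y2: "y2 \<in> carrier S" "y' \<lless> y2" "y2 \<lless> y"
    using way_below_interpolate[OF y'(2,1) y] .
  have "k \<cdot> y2 \<lless> x \<oplus> w"
    using way_below_leq_trans[OF nsmult_way_below yx] y2 y x wc by simp
  then obtain z where z: "z \<in> carrier S" "k \<cdot> z \<preceq> x" "y' \<preceq> z \<oplus> w"
    using lift_multiple_mod_idempotent[OF O6 O8 wc w(2) _ y2(2) y'(1) y2(1) x(2)] by blast
  have "q \<cdot> y' \<preceq> q \<cdot> (z \<oplus> w)" by (rule nsmult_mono) (use z y' wc in auto)
  moreover have "q \<cdot> (z \<oplus> w) = q \<cdot> z \<oplus> q \<cdot> w" using z wc by (simp only: nat_pow_distrib)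
  moreover have "q \<cdot> z \<oplus> q \<cdot> w \<preceq> q \<cdot> z \<oplus> w"
    by (rule add_mono2) (use z wc w in \<open>auto simp: nsmult_idempotent_leq leq_refl\<close>)
  ultimately have "q \<cdot> y' \<preceq> q \<cdot> z \<oplus> w"
    using leq_trans[of "q \<cdot> y'" "q \<cdot> z \<oplus> q \<cdot> w"] y' z wc by simp
  then have "q \<cdot> y' \<oplus> w \<preceq> (q \<cdot> z \<oplus> w) \<oplus> w"
    using add_mono[of "q \<cdot> y'" "q \<cdot> z \<oplus> w" w] y' z wc by simp
  moreover have "(q \<cdot> z \<oplus> w) \<oplus> w = q \<cdot> z \<oplus> w" using z wc w by (simp only: m_assoc nat_pow_closed)
  ultimately have "x' \<preceq> q \<cdot> z \<oplus> w"
    using leq_trans[OF _ _ _ y'(3)] x y' z wc by simp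
  then show thesis using that z w unfolding q_def by blast
qed

section \<open>Complements and the part of an element inside the ideal\<close>

text \<open>
  Choose \<open>z1 \<lless> z2 \<lless> z3 \<lless> z\<close>. One copy of \<open>k \<cdot> z\<close> in \<open>x\<close>, shrunk to \<open>k \<cdot> z2\<close>, is complemented by (O5);
  the other one is used for the last clause of (O5), which keeps \<open>k \<cdot> z3\<close> inside the
  complement \<open>u\<close>. Hence \<open>x \<preceq> k \<cdot> z2 \<oplus> u \<preceq> u \<oplus> u\<close>. The order \<open>z2 \<preceq> z3\<close> makes this work.
\<close>

lemma half_complement:
  assumes O5: "axiom_O5 S"
    and le: "(2 * k) \<cdot> z \<preceq> x" and wb: "z1 \<lless> z"
    and c: "z1 \<in> carrier S" "z \<in> carrier S" "x \<in> carrier S"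
  obtains u where "u \<in> carrier S" "k \<cdot> z1 \<oplus> u \<preceq> x" "x \<preceq> u \<oplus> u"
proof -
  obtain z2 where z2: "z2 \<in> carrier S" "z1 \<lless> z2" "z2 \<lless> z"
    using way_below_interpolate[OF wb c(1,2)] .
  obtain z3 where z3: "z3 \<in> carrier S" "z2 \<lless> z3" "z3 \<lless> z"
    using way_below_interpolate[OF z2(3,1) c(2)] .
  have "k \<cdot> z2 \<oplus> k \<cdot> z \<preceq> k \<cdot> z \<oplus> k \<cdot> z"
    by (intro add_mono nsmult_mono way_below_leq) (use z2 c in auto)
  moreover have "k \<cdot> z \<oplus> k \<cdot> z \<preceq> x" using le c by (simp add: nat_pow_mult mult_2)
  ultimately have "k \<cdot> z2 \<oplus> k \<cdot> z \<preceq> x"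
    using leq_trans[of _ "k \<cdot> z \<oplus> k \<cdot> z" x] z2 c by simp
  moreover have "k \<cdot> z1 \<lless> k \<cdot> z2" "k \<cdot> z3 \<lless> k \<cdot> z"
    using nsmult_way_below z2 z3 c by blast+
  ultimately obtain u where u: "u \<in> carrier S" "k \<cdot> z1 \<oplus> u \<preceq> x" "x \<preceq> k \<cdot> z2 \<oplus> u" "k \<cdot> z3 \<lless> u"
    using O5[unfolded axiom_O5_def, rule_format, of "k \<cdot> z1" "k \<cdot> z2" "k \<cdot> z3" "k \<cdot> z" x] z2 z3 c
    by auto
  have "k \<cdot> z2 \<preceq> u"
    using leq_trans[OF _ _ _ nsmult_mono[OF _ _ way_below_leq[OF z3(2)]] way_below_leq[OF u(4)]]
      z2 z3 u by simp
  then have "k \<cdot> z2 \<oplus> u \<preceq> u \<oplus> u" using z2 u by (intro add_mono) auto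
  then have "x \<preceq> u \<oplus> u" using leq_trans[OF _ _ _ u(3)] z2 u c by simp
  then show thesis using that u by blast
qed

text \<open>
  By (O6), \<open>f\<close> is covered by two elements \<open>f1\<close>, \<open>f2\<close> of \<open>I\<close> below \<open>u\<close>. Their sum need not be below
  \<open>u\<close>, but (O7) provides \<open>g \<preceq> u\<close> above both (up to compact containment), and \<open>g \<preceq> f1 \<oplus> f2\<close> keeps
  \<open>g\<close> in \<open>I\<close>.
\<close>

lemma ideal_part_below_half:
  assumes O6: "axiom_O6 S" and O7: "axiom_O7 S" and I: "cu_ideal I S"
    and wb: "f' \<lless> f" and f: "f' \<in> carrier S" "f \<in> I" and le: "f \<preceq> u \<oplus> u" and u: "u \<in> carrier S"
  obtains g' g where "g' \<in> I" "g \<in> I" "g' \<lless> g" "g \<preceq> u" "f' \<preceq> g' \<oplus> g'"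
proof -
  interpret cu_ideal I S by (rule I)
  have fc: "f \<in> carrier S" using f ideal_subset by blast
  obtain f0 where f0: "f0 \<in> carrier S" "f' \<lless> f0" "f0 \<lless> f"
    using way_below_interpolate[OF wb f(1) fc] .
  obtain f1 f2 where f12: "f1 \<in> carrier S" "f2 \<in> carrier S" "f0 \<preceq> f1 \<oplus> f2"
    "f1 \<preceq> f" "f1 \<preceq> u" "f2 \<preceq> f" "f2 \<preceq> u"
    using O6[unfolded axiom_O6_def, rule_format, of f0 f u u] f0 le u fc by auto
  obtain f0' where f0': "f0' \<in> carrier S" "f' \<lless> f0'" "f0' \<lless> f0"
    using way_below_interpolate[OF f0(2) f(1) f0(1)] .
  obtain h1 where h1: "h1 \<in> carrier S" "h1 \<lless> f1" "f0' \<preceq> h1 \<oplus> f2"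
    using way_below_approx_add[OF f0'(3) f12(3,1,2)] .
  have "f0' \<preceq> f2 \<oplus> h1" using h1 f12 by (simp add: m_comm)
  then obtain h2 where h2: "h2 \<in> carrier S" "h2 \<lless> f2" "f' \<preceq> h2 \<oplus> h1"
    using way_below_approx_add[OF f0'(2) _ f12(2) h1(1)] by blast
  obtain g where g: "g \<in> carrier S" "h1 \<lless> g" "h2 \<lless> g" "g \<preceq> u" "g \<preceq> f1 \<oplus> f2"
    using O7[unfolded axiom_O7_def, rule_format, of h1 f1 h2 f2 u] h1 h2 f12 u by auto
  have "f1 \<in> I" "f2 \<in> I" using ideal_down f f12 by blast+
  then have gI: "g \<in> I" using ideal_down[OF g(1) _ g(5)] ideal_add by blast
  obtain g' where g': "g' \<in> carrier S" "g' \<lless> g" "h1 \<preceq> g'" "h2 \<preceq> g'"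
    using way_below_approx2[OF g(2,3) h1(1) h2(1) g(1)] .
  have "g' \<in> I" using ideal_down[OF g'(1) gI way_below_leq] g' g by blast
  moreover have "h2 \<oplus> h1 \<preceq> g' \<oplus> g'" using h1 h2 g' by (intro add_mono2) auto
  then have "f' \<preceq> g' \<oplus> g'" using leq_trans[OF _ _ _ h2(3)] f h1 h2 g' by simp
  ultimately show thesis using that gI g g' by blast
qed

end

section \<open>Almost divisibility of extensions\<close>

theorem proposition4p8:
  fixes S :: "'a ord_monoid" and I :: "'a set" and n1 n2 :: nat
  assumes "cu_semigroup S"
    and "axiom_O5 S" and "axiom_O6 S" and "axiom_O7 S" and "axiom_O8 S"
    and "cu_ideal I S"
    and "almost_divisible n1 (cu_quotient S I)"
    and "almost_divisible n2 (ideal_structure S I)"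
  shows "almost_divisible (max (2 * n1 + 1) (2 * n2 + 1)) S"
  unfolding almost_divisible_def
proof (intro allI ballI impI)
  fix k :: nat and x' x
  assume x: "x' \<in> carrier S" "x \<in> carrier S" and wb: "x' \<lless>\<^bsub>S\<^esub> x"
  interpret cu_semigroup S by (rule assms(1))
  interpret cu_ideal I S by (rule assms(6))
  define q p r where "q = (2 * k + 1) * (n1 + 1)" and "p = (k + 1) * (n2 + 1)"
    and "r = (k + 1) * (max (2 * n1 + 1) (2 * n2 + 1) + 1)"
  note qpr = this
  obtain x1 where x1: "x1 \<in> carrier S" "x' \<lless>\<^bsub>S\<^esub> x1" "x1 \<lless>\<^bsub>S\<^esub> x"
    using way_below_interpolate[OF wb x] .
  obtain x2 where x2: "x2 \<in> carrier S" "x' \<lless>\<^bsub>S\<^esub> x2" "x2 \<lless>\<^bsub>S\<^esub> x1"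
    using way_below_interpolate[OF x1(2) x(1) x1(1)] .
  obtain x3 where x3: "x3 \<in> carrier S" "x' \<lless>\<^bsub>S\<^esub> x3" "x3 \<lless>\<^bsub>S\<^esub> x2"
    using way_below_interpolate[OF x2(2) x(1) x2(1)] .
  \<comment> \<open>Dividing by \<open>2 * k\<close> leaves room for a second copy of \<open>k \<cdot> z\<close> in \<open>x\<close>.\<close>
  obtain z w where z: "z \<in> carrier S" and w: "w \<in> I"
    and zx: "(2 * k) \<cdot>\<^bsub>S\<^esub> z \<preceq>\<^bsub>S\<^esub> x" and xz: "x1 \<preceq>\<^bsub>S\<^esub> q \<cdot>\<^bsub>S\<^esub> z \<oplus>\<^bsub>S\<^esub> w"
    using quotient_almost_divisible_lift[OF assms(3,5,6,7) x1(3,1) x(2), of "2 * k"] unfolding qpr(1) .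
  have wc: "w \<in> carrier S" using w ideal_subset by blast
  obtain z1 where z1: "z1 \<in> carrier S" "z1 \<lless>\<^bsub>S\<^esub> z" "x2 \<preceq>\<^bsub>S\<^esub> q \<cdot>\<^bsub>S\<^esub> z1 \<oplus>\<^bsub>S\<^esub> w"
    using way_below_approx[OF x2(3) xz z wc] .
  obtain u where u: "u \<in> carrier S" "k \<cdot>\<^bsub>S\<^esub> z1 \<oplus>\<^bsub>S\<^esub> u \<preceq>\<^bsub>S\<^esub> x" "x \<preceq>\<^bsub>S\<^esub> u \<oplus>\<^bsub>S\<^esub> u"
    using half_complement[OF assms(2) zx z1(2,1) z x(2)] .
  \<comment> \<open>\<open>e\<close> and \<open>f\<close> together cover \<open>x3\<close>; \<open>f\<close> is in \<open>I\<close> and still below \<open>x\<close>, hence below \<open>u \<oplus> u\<close>.\<close>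
  obtain e f where ef: "e \<in> carrier S" "f \<in> carrier S" "x3 \<preceq>\<^bsub>S\<^esub> f \<oplus>\<^bsub>S\<^esub> e"
    "e \<preceq>\<^bsub>S\<^esub> q \<cdot>\<^bsub>S\<^esub> z1" "f \<preceq>\<^bsub>S\<^esub> x2" "f \<preceq>\<^bsub>S\<^esub> w"
    using assms(3)[unfolded axiom_O6_def, rule_format, of x3 x2 "q \<cdot>\<^bsub>S\<^esub> z1" w] x2 x3 z1 wc
    by (auto simp: m_comm)
  have fI: "f \<in> I" using ideal_down ef w by blast
  obtain f' where f': "f' \<in> carrier S" "f' \<lless>\<^bsub>S\<^esub> f" "x' \<preceq>\<^bsub>S\<^esub> f' \<oplus>\<^bsub>S\<^esub> e"
    using way_below_approx_add[OF x3(2) ef(3,2,1)] .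
  have "x2 \<preceq>\<^bsub>S\<^esub> x" using leq_trans[OF _ _ _ way_below_leq[OF x2(3)] way_below_leq[OF x1(3)]] x x1 x2 by blast
  then have "f \<preceq>\<^bsub>S\<^esub> x" using leq_trans[OF _ _ _ ef(5)] ef x x2 by blast
  then have "f \<preceq>\<^bsub>S\<^esub> u \<oplus>\<^bsub>S\<^esub> u" using leq_trans[OF _ _ _ _ u(3)] ef x u by simp
  then obtain g' g where g: "g' \<in> I" "g \<in> I" "g' \<lless>\<^bsub>S\<^esub> g" "g \<preceq>\<^bsub>S\<^esub> u" "f' \<preceq>\<^bsub>S\<^esub> g' \<oplus>\<^bsub>S\<^esub> g'"
    using ideal_part_below_half[OF assms(3,4,6) f'(2,1) fI _ u(1)] by blast
  obtain v where v: "v \<in> I" "k \<cdot>\<^bsub>S\<^esub> v \<preceq>\<^bsub>S\<^esub> g" "g' \<preceq>\<^bsub>S\<^esub> p \<cdot>\<^bsub>S\<^esub> v"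
    using assms(8)[unfolded almost_divisible_def, rule_format, of g' g k, folded qpr(2)]
      way_below_ideal[OF assms(6) g(3,2)] g(1,2)
    by (auto simp flip: nat_pow_consistent)
  have c: "g' \<in> carrier S" "g \<in> carrier S" "v \<in> carrier S" using g v ideal_subset by auto
  have "k \<cdot>\<^bsub>S\<^esub> z1 \<oplus>\<^bsub>S\<^esub> k \<cdot>\<^bsub>S\<^esub> v \<preceq>\<^bsub>S\<^esub> k \<cdot>\<^bsub>S\<^esub> z1 \<oplus>\<^bsub>S\<^esub> u"
    using leq_trans[OF _ _ _ v(2) g(4)] z1 c u by (intro add_mono2) (auto simp: leq_refl)
  then have "k \<cdot>\<^bsub>S\<^esub> (z1 \<oplus>\<^bsub>S\<^esub> v) \<preceq>\<^bsub>S\<^esub> x"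
    using leq_trans[OF _ _ _ _ u(2)] z1 c u x by (simp add: nat_pow_distrib)
  moreover have "x' \<preceq>\<^bsub>S\<^esub> r \<cdot>\<^bsub>S\<^esub> (z1 \<oplus>\<^bsub>S\<^esub> v)"
  proof -
    have "q \<le> (k + 1) * (2 * n1 + 2)" by (simp add: qpr algebra_simps)
    also have "\<dots> \<le> r" unfolding qpr by (intro mult_le_mono) auto
    finally have q_le: "q \<le> r" .
    have "p + p = (k + 1) * (2 * n2 + 2)" by (simp add: qpr algebra_simps)
    also have "\<dots> \<le> r" unfolding qpr by (intro mult_le_mono) auto
    finally have p_le: "p + p \<le> r" .
    have "g' \<oplus>\<^bsub>S\<^esub> g' \<preceq>\<^bsub>S\<^esub> p \<cdot>\<^bsub>S\<^esub> v \<oplus>\<^bsub>S\<^esub> p \<cdot>\<^bsub>S\<^esub> v"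
      by (rule add_mono2) (use c v in auto)
    also have "p \<cdot>\<^bsub>S\<^esub> v \<oplus>\<^bsub>S\<^esub> p \<cdot>\<^bsub>S\<^esub> v = (p + p) \<cdot>\<^bsub>S\<^esub> v" using c by (simp only: nat_pow_mult)
    finally have "f' \<preceq>\<^bsub>S\<^esub> (p + p) \<cdot>\<^bsub>S\<^esub> v"
      using leq_trans[OF _ _ _ g(5)] f' c by blast
    then have fv: "f' \<preceq>\<^bsub>S\<^esub> r \<cdot>\<^bsub>S\<^esub> v"
      using leq_trans[OF _ _ _ _ nsmult_mono_left[OF _ p_le]] f' c nat_pow_closed by blast
    have ez: "e \<preceq>\<^bsub>S\<^esub> r \<cdot>\<^bsub>S\<^esub> z1"
      using leq_trans[OF _ _ _ ef(4) nsmult_mono_left[OF _ q_le]] ef z1 nat_pow_closed by blast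
    have "f' \<oplus>\<^bsub>S\<^esub> e \<preceq>\<^bsub>S\<^esub> r \<cdot>\<^bsub>S\<^esub> v \<oplus>\<^bsub>S\<^esub> r \<cdot>\<^bsub>S\<^esub> z1"
      by (rule add_mono2[OF _ _ _ _ fv ez]) (use f' ef c z1 in auto)
    also have "\<dots> = r \<cdot>\<^bsub>S\<^esub> (z1 \<oplus>\<^bsub>S\<^esub> v)"
      using c z1 by (simp only: m_comm[of z1 v] nat_pow_distrib)
    finally show ?thesis
      using leq_trans[OF _ _ _ f'(3)] x f' ef c z1 by (meson m_closed nat_pow_closed)
  qed
  ultimately show "\<exists>y\<in>carrier S. k \<cdot>\<^bsub>S\<^esub> y \<preceq>\<^bsub>S\<^esub> x \<and> x' \<preceq>\<^bsub>S\<^esub> ((k + 1) * (max (2 * n1 + 1) (2 * n2 + 1) + 1)) \<cdot>\<^bsub>S\<^esub> y"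
    using z1 c unfolding qpr(3) by blast
qed

end
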